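(* Let $R$ be a ring with involution, let $a\in R$ be Drazin invertible, let $b\in R$ and $f=a+b$. If $f$ is Drazin invertible with ${\rm i}(f)=k$, then the following statements are equivalent: (1) $a^{D}(a+f)f^{D}=a^D+f^{D}$; (2) $1+a^{D}b$ is invertible and $f^{D}=(1+a^{D}b)^{-1}a^{D}$; (3) $1+a^{D}b$ is invertible, $aa^Db=baa^D$ and $(1-aa^D)(a+b)^k=0$; (4) $1+a^{D}b$ is invertible, $(1-aa^D)baa^D=0$ and $(a+b)^k(1-aa^D)=0$; (5) $1+a^{D}b$ is invertible, $aa^Db(1-aa^D)=0$ and $(1-aa^D)(a+b)^k=0$.
   Context: Rings are associative with identity $1$. An element $a\in R$ is Drazin invertible if there are $x\in R$ and a positive integer $k$ with $xa^{k+1}=a^k$, $ax^2=x$, $xa=ax$; then $x$ is unique and denoted $a^D$, and the smallest positive integer $k$ for which these equations hold is the Drazin index ${\rm i}(a)$. *)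

theory Defs
  imports Main
begin

text \<open>
  The sort \<open>{ring, monoid_mult}\<close> describes associative, not necessarily commutative rings with
  identity. It is used instead of \<open>ring_1\<close> because the latter excludes the zero ring.
\<close>

definition ring_involution :: "('a::{ring, monoid_mult} \<Rightarrow> 'a) \<Rightarrow> bool" where
  "ring_involution star \<longleftrightarrow>
     (\<forall>x. star (star x) = x) \<and>
     (\<forall>x y. star (x + y) = star x + star y) \<and>
     (\<forall>x y. star (x * y) = star y * star x)"

definition ring_invertible :: "'a::{ring, monoid_mult} \<Rightarrow> bool" where
  "ring_invertible u \<longleftrightarrow> (\<exists>v. u * v = 1 \<and> v * u = 1)"

text \<open>Meaningful only for invertible arguments, and unspecified otherwise.\<close>

definition ring_inverse :: "'a::{ring, monoid_mult} \<Rightarrow> 'a" where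
  "ring_inverse u = (THE v. u * v = 1 \<and> v * u = 1)"

definition drazin_eqs :: "'a::{ring, monoid_mult} \<Rightarrow> nat \<Rightarrow> 'a \<Rightarrow> bool" where
  "drazin_eqs a k x \<longleftrightarrow> x * a ^ (k + 1) = a ^ k \<and> a * x ^ 2 = x \<and> x * a = a * x"

definition drazin_invertible :: "'a::{ring, monoid_mult} \<Rightarrow> bool" where
  "drazin_invertible a \<longleftrightarrow> (\<exists>x k. k > 0 \<and> drazin_eqs a k x)"

text \<open>
  The Drazin inverse and the Drazin index are meaningful only for Drazin invertible arguments.
  The index is positive by convention, so the index of a unit is 1, not 0.
\<close>

definition drazin_inverse :: "'a::{ring, monoid_mult} \<Rightarrow> 'a"  ("_\<^sup>D" [1000] 999) where
  "a\<^sup>D = (THE x. \<exists>k>0. drazin_eqs a k x)"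

definition drazin_index :: "'a::{ring, monoid_mult} \<Rightarrow> nat" where
  "drazin_index a = (LEAST k. k > 0 \<and> drazin_eqs a k (a\<^sup>D))"

lemma ring_inverse_eqI:
  assumes "u * v = 1" "v * u = 1"
  shows "ring_inverse u = v"
  unfolding ring_inverse_def
proof (rule the_equality)
  fix w assume "u * w = 1 \<and> w * u = 1"
  then show "w = v" using assms by (metis mult.assoc mult_1_left mult_1_right)
qed (use assms in simp)

lemma drazin_eqs_powers:
  assumes "drazin_eqs a k x" "k \<le> m"
  shows "x * a ^ (m + 1) = a ^ m" "a ^ (m + 1) * x = a ^ m"
    "x ^ (m + 1) * a ^ m = x" "a ^ m * x ^ (m + 1) = x"
proof -
  have ka: "x * a ^ (k + 1) = a ^ k" and ax: "a * x ^ 2 = x" and c: "x * a = a * x"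
    using assms(1) by (auto simp: drazin_eqs_def)
  have comm: "x ^ i * a ^ j = a ^ j * x ^ i" for i j
    using c by (metis power_commuting_commutes)
  obtain d where d: "m = k + d" using assms(2) le_Suc_ex by blast
  have "x * a ^ (m + 1) = (x * a ^ (k + 1)) * a ^ d"
    unfolding d by (simp add: mult.assoc flip: power_add power_Suc)
  then show *: "x * a ^ (m + 1) = a ^ m" using ka by (simp add: d power_add)
  then show "a ^ (m + 1) * x = a ^ m" using comm[of 1 "m + 1"] by simp
  show **: "a ^ m * x ^ (m + 1) = x"
  proof (induction m)
    case (Suc m)
    have "a ^ Suc m * x ^ (Suc m + 1) = (a ^ m * a) * (x ^ 2 * x ^ m)"
      by (simp only: power_Suc2 flip: power_add) simp
    also have "\<dots> = a ^ m * (a * x ^ 2) * x ^ m" by (simp only: mult.assoc)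
    also have "\<dots> = a ^ m * x ^ (m + 1)" by (simp add: ax mult.assoc)
    finally show ?case using Suc by simp
  qed simp
  then show "x ^ (m + 1) * a ^ m = x" by (simp only: comm)
qed

lemma drazin_eqs_unique:
  assumes "drazin_eqs a k x" "drazin_eqs a l y"
  shows "x = y"
proof -
  define m where "m = max k l"
  note X = drazin_eqs_powers[OF assms(1), of m] and Y = drazin_eqs_powers[OF assms(2), of m]
  have le: "k \<le> m" "l \<le> m" by (auto simp: m_def)
  have "x = x ^ (m + 1) * (a ^ (m + 1) * y)" using X Y le by simp
  also have "\<dots> = (x ^ (m + 1) * a ^ m) * a * y"
    by (simp only: power_add power_one_right mult.assoc)
  finally have 1: "x = x * a * y" using X le by simp
  have "y = (x * a ^ (m + 1)) * y ^ (m + 1)" using X Y le by simp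
  also have "\<dots> = x * a * (a ^ m * y ^ (m + 1))"
    by (simp add: mult.assoc)
  finally have "y = x * a * y" using Y le by simp
  with 1 show ?thesis by simp
qed

lemma drazin_inverse_eqI:
  assumes "drazin_eqs a k x" "k > 0"
  shows "a\<^sup>D = x"
  unfolding drazin_inverse_def using assms drazin_eqs_unique by blast

lemma drazin_index:
  assumes "drazin_invertible a"
  shows "drazin_index a > 0" "drazin_eqs a (drazin_index a) (a\<^sup>D)"
proof -
  obtain x k where k: "k > 0" "drazin_eqs a k x" using assms drazin_invertible_def by blast
  then have "k > 0 \<and> drazin_eqs a k (a\<^sup>D)" using drazin_inverse_eqI by blast
  then show "drazin_index a > 0" "drazin_eqs a (drazin_index a) (a\<^sup>D)"
    unfolding drazin_index_def by (metis (mono_tags, lifting) LeastI)+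
qed

end

theory Submission
  imports Defs
begin

text \<open>
  Write \<open>x = a\<^sup>D\<close>, \<open>y = f\<^sup>D\<close>, \<open>e = a x\<close>, \<open>g = f y\<close>, so that \<open>e\<close> and \<open>g\<close> are idempotents commuting
  with \<open>a\<close> and \<open>f\<close> respectively. Number the five conditions of the theorem in order of appearance,
  the common left hand side being (1). Each of them says \<open>e = g\<close>.

  Condition (1) reads \<open>e y + x g = x + y\<close>, that is \<open>(1 - e) y = - x (1 - g)\<close>. Left multiplication
  by \<open>e\<close> kills the left hand side and fixes the right hand side, so both vanish. Now \<open>y = e y\<close>
  gives \<open>g = e g\<close>, and \<open>x = x g\<close> gives \<open>e = e g\<close> (lemmas \<open>absorption_law_iff\<close> and
  \<open>absorption_iff_same_projection\<close>). Condition (2) yields the same two equations: multiplied out,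
  \<open>(1 + x b) y = x\<close> reads \<open>(1 - e) y + x g = x\<close>.

  If \<open>e = g\<close>, then \<open>1 + x b\<close> and \<open>1 - y b\<close> are inverse to each other, \<open>(1 - y b) x = y\<close>, the
  idempotent \<open>e\<close> commutes with \<open>a\<close>, \<open>f\<close> and hence \<open>b\<close>, and \<open>1 - e = 1 - g\<close> kills \<open>f ^ k\<close> on both
  sides. This gives (2)--(5).

  Condition (3) implies (5), since \<open>e b = b e\<close> gives \<open>e b (1 - e) = b e (1 - e) = 0\<close>. For the
  way back from (4) and (5), the hypotheses make \<open>e\<close> a left identity for \<open>f ^ k\<close>, whence \<open>e g = g\<close>. Invertibility of
  \<open>1 + x b = (1 - e) + x f\<close> gives a left inverse \<open>w\<close> of \<open>f\<close> relative to \<open>e\<close>: \<open>w f e = e\<close> in (4) and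
  \<open>w f = e\<close> in (5). There \<open>f\<close> is block triangular with respect to \<open>e\<close>, that is
  \<open>(1 - e) f e = 0\<close> in (4) and \<open>e f (1 - e) = 0\<close> in (5), so the relation can be iterated
  and writes \<open>e\<close> as a left multiple of \<open>f ^ k\<close>, which gives \<open>e = e g\<close> (lemma \<open>projections_eqI\<close>).
\<close>

section \<open>The idempotent of a Drazin inverse\<close>

lemma drazin_eqs_projection:
  assumes "drazin_eqs a k x"
  shows "x * a = a * x" "a * x * x = x" "x * (a * x) = x" "a * x * (a * x) = a * x"
    "a * x * a = a * (a * x)"
proof -
  show c: "x * a = a * x" and 1: "a * x * x = x"
    using assms by (auto simp: drazin_eqs_def power2_eq_square mult.assoc)
  then show 2: "x * (a * x) = x" by (metis mult.assoc)
  show "a * x * (a * x) = a * x" using 2 by (simp add: mult.assoc)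
  show "a * x * a = a * (a * x)" using c by (simp add: mult.assoc)
qed

lemma drazin_eqs_power_absorb:
  assumes "drazin_eqs a k x"
  shows "a * x * a ^ k = a ^ k" "a ^ k * (a * x) = a ^ k"
proof -
  have "a * x * a ^ k = x * a ^ (k + 1)"
    using drazin_eqs_projection(1)[OF assms] by (simp flip: mult.assoc)
  then show "a * x * a ^ k = a ^ k" using drazin_eqs_powers(1)[OF assms] by simp
  have "a ^ k * (a * x) = a ^ (k + 1) * x"
    by (simp only: power_add power_one_right mult.assoc)
  then show "a ^ k * (a * x) = a ^ k" using drazin_eqs_powers(2)[OF assms] by simp
qed

section \<open>The absorption law as equality of idempotents\<close>

lemma absorption_law_iff:
  assumes a: "drazin_eqs a m x" and f: "drazin_eqs f k y"
  shows "x * (a + f) * y = x + y \<longleftrightarrow> x * (f * y) = x \<and> a * x * y = y"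
proof -
  note A = drazin_eqs_projection[OF a]
  have expand: "x * (a + f) * y = a * x * y + x * (f * y)"
    using A(1) by (simp add: distrib_left distrib_right mult.assoc)
  show ?thesis
  proof
    assume "x * (a + f) * y = x + y"
    then have law: "a * x * y + x * (f * y) = x + y" by (simp add: expand)
    have "a * x * (a * x * y + x * (f * y)) = a * x * (x + y)" by (simp only: law)
    moreover have "a * x * (a * x * y + x * (f * y)) = a * x * y + x * (f * y)"
      using A(2,4) by (simp add: distrib_left flip: mult.assoc)
    moreover have "a * x * (x + y) = x + a * x * y" using A(2) by (simp add: distrib_left)
    ultimately have "x * (f * y) = x" by simp
    then show "x * (f * y) = x \<and> a * x * y = y" using law by simp
  next
    assume "x * (f * y) = x \<and> a * x * y = y"
    then show "x * (a + f) * y = x + y" by (simp add: expand)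
  qed
qed

lemma absorption_iff_same_projection:
  assumes a: "drazin_eqs a m x" and f: "drazin_eqs f k y"
  shows "x * (f * y) = x \<and> a * x * y = y \<longleftrightarrow> a * x = f * y"
proof
  assume H: "x * (f * y) = x \<and> a * x * y = y"
  have "a * x = a * x * (f * y)" using H by (simp add: mult.assoc)
  also have "\<dots> = a * x * y * f"
    using drazin_eqs_projection(1)[OF f] by (simp add: mult.assoc)
  also have "\<dots> = f * y" using H drazin_eqs_projection(1)[OF f] by simp
  finally show "a * x = f * y" .
next
  assume "a * x = f * y"
  then show "x * (f * y) = x \<and> a * x * y = y"
    using drazin_eqs_projection(3)[OF a] drazin_eqs_projection(2)[OF f] by metis
qed

text \<open>
  The equation \<open>(1 + x b) y = x\<close> has the form \<open>(1 - e) y + x g = x\<close>; multiplication by \<open>e\<close> separates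
  the two summands.
\<close>

lemma absorption_of_solution:
  assumes a: "drazin_eqs a m x" and f: "drazin_eqs f k y"
    and eq: "(1 + x * (f - a)) * y = x"
  shows "x * (f * y) = x \<and> a * x * y = y"
proof -
  note A = drazin_eqs_projection[OF a]
  have split: "y + x * (f * y) - a * x * y = x"
    using eq A(1)
    by (simp add: distrib_right left_diff_distrib right_diff_distrib add_diff_eq flip: mult.assoc)
  have "a * x * (y + x * (f * y) - a * x * y) = a * x * x" by (simp only: split)
  moreover have "a * x * (y + x * (f * y) - a * x * y) = x * (f * y)"
    using A(2,4) by (simp add: distrib_left right_diff_distrib flip: mult.assoc)
  ultimately have "x * (f * y) = x" using A(2) by simp
  then show ?thesis using split by (simp add: algebra_simps)
qed

section \<open>Consequences of equal idempotents\<close>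

text \<open>
  With \<open>b = f - a\<close>, the hypothesis \<open>a x = f y\<close> yields the resolvent identity \<open>x b y = x - y\<close>, which
  is what makes \<open>1 + x b\<close> and \<open>1 - y b\<close> inverse to each other. The statement is symmetric under
  exchanging \<open>(a, x)\<close> and \<open>(f, y)\<close>, so it provides the two-sided inverse.
\<close>

lemma same_projection_inverse:
  assumes a: "drazin_eqs a m x" and f: "drazin_eqs f k y" and eq: "a * x = f * y"
  shows "(1 + x * (f - a)) * (1 + y * (a - f)) = 1" "(1 + y * (a - f)) * x = y"
proof -
  note A = drazin_eqs_projection[OF a] and F = drazin_eqs_projection[OF f]
  have xa: "x * a = f * y" and yf: "y * f = f * y" using A(1) F(1) eq by auto
  have resolvent: "x * (f - a) * y = x - y"
  proof -
    have "x * (f - a) * y = x * (f * y) - x * a * y"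
      by (simp add: left_diff_distrib right_diff_distrib mult.assoc)
    then show ?thesis using A(3) F(2) xa eq by simp
  qed
  have "(1 + x * (f - a)) * (1 + y * (a - f))
      = 1 + x * (f - a) + y * (a - f) + x * (f - a) * y * (a - f)"
    by (simp only: distrib_left distrib_right mult_1_left mult_1_right mult.assoc add.assoc)
  also have "\<dots> = 1 + (x * f - f * y) + (y * a - f * y) + (x - y) * (a - f)"
    unfolding resolvent by (simp add: right_diff_distrib xa yf)
  also have "(x - y) * (a - f) = f * y - x * f - (y * a - f * y)"
    by (simp add: right_diff_distrib left_diff_distrib xa yf)
  finally show "(1 + x * (f - a)) * (1 + y * (a - f)) = 1" by simp
  have "(1 + y * (a - f)) * x = x + (y * (a * x) - y * f * x)"
    by (simp add: distrib_right left_diff_distrib right_diff_distrib mult.assoc)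
  also have "\<dots> = y" using F(3) A(2) eq yf by simp
  finally show "(1 + y * (a - f)) * x = y" .
qed

lemma same_projection_ring_inverse:
  assumes "drazin_eqs a m x" "drazin_eqs f k y" "a * x = f * y"
  shows "ring_invertible (1 + x * (f - a))" "y = ring_inverse (1 + x * (f - a)) * x"
proof -
  note 1 = same_projection_inverse[OF assms]
    and 2 = same_projection_inverse(1)[OF assms(2,1) assms(3)[symmetric]]
  show "ring_invertible (1 + x * (f - a))" using 1(1) 2 ring_invertible_def by blast
  show "y = ring_inverse (1 + x * (f - a)) * x"
    using ring_inverse_eqI[OF 1(1) 2] 1(2) by simp
qed

lemma same_projection_consequences:
  assumes a: "drazin_eqs a m x" and f: "drazin_eqs f k y" and eq: "a * x = f * y"
  shows "a * x * (f - a) = (f - a) * (a * x)"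
    "(1 - a * x) * f ^ k = 0" "f ^ k * (1 - a * x) = 0"
proof -
  note A = drazin_eqs_projection[OF a] and F = drazin_eqs_projection[OF f]
  show "a * x * (f - a) = (f - a) * (a * x)"
    using A(5) F(5) eq by (simp add: left_diff_distrib right_diff_distrib)
  show "(1 - a * x) * f ^ k = 0" "f ^ k * (1 - a * x) = 0"
    using drazin_eqs_power_absorb[OF f] eq by (simp_all add: left_diff_distrib right_diff_distrib)
qed

section \<open>Equal idempotents from triangularity\<close>

text \<open>
  Since \<open>f y\<close> is a right multiple of \<open>f ^ k\<close>, left identities of \<open>f ^ k\<close> are left identities of
  \<open>f y\<close>; and any left multiple of \<open>f ^ k\<close> is fixed by right multiplication with \<open>f y\<close>.
\<close>

lemma projections_eqI:
  assumes f: "drazin_eqs f k y"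
    and left: "e * f ^ k = f ^ k" and mult: "e = s * f ^ k"
  shows "e = f * y"
proof -
  have "f * y = f * (f ^ k * y ^ (k + 1))" using drazin_eqs_powers(4)[OF f] by simp
  also have "\<dots> = f ^ k * (f * y ^ (k + 1))"
    by (simp add: power_commutes flip: mult.assoc)
  finally have "e * (f * y) = f * y" using left by (metis mult.assoc)
  moreover have "e * (f * y) = e" using mult drazin_eqs_power_absorb(2)[OF f]
    by (simp add: mult.assoc)
  ultimately show ?thesis by simp
qed

lemma invariant_corner_power:
  fixes e f :: "'a::{ring, monoid_mult}"
  assumes "e * e = e" "f * e = e * (f * e)"
  shows "f ^ n * e = e * (f ^ n * e)"
proof (induction n)
  case (Suc n)
  have "f ^ Suc n * e = f * e * (f ^ n * e)" by (simp add: mult.assoc flip: Suc.IH)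
  then show ?case using assms(2) by (metis mult.assoc Suc.IH power_Suc)
qed (simp add: assms)

text \<open>
  Invariance of the corner lets the relation \<open>e = w f e\<close> be substituted into itself: the factor
  \<open>f e\<close> equals \<open>e f e\<close>, and its leading \<open>e\<close> can be expanded again.
\<close>

lemma left_inverse_power_invariant:
  fixes e f w :: "'a::{ring, monoid_mult}"
  assumes inv: "f * e = e * (f * e)" and w: "w * (f * e) = e"
  shows "e = w ^ n * (f ^ n * e)"
proof (induction n)
  case (Suc n)
  have "e = w * (e * (f * e))" using w inv by simp
  also have "\<dots> = w * (w ^ n * (f ^ n * e) * (f * e))" by (simp flip: Suc.IH)
  also have "\<dots> = w ^ Suc n * (f ^ n * (e * (f * e)))" by (simp add: mult.assoc)
  also have "\<dots> = w ^ Suc n * (f ^ Suc n * e)"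
    by (simp only: inv[symmetric] power_Suc2 mult.assoc)
  finally show ?case .
qed simp

text \<open>
  Substituting \<open>e = w f\<close> into itself needs a factor \<open>e\<close> between \<open>w\<close> and \<open>f\<close>; \<open>w e = w\<close> supplies it.
\<close>

lemma left_inverse_power_coinvariant:
  fixes e f w :: "'a::{ring, monoid_mult}"
  assumes we: "w * e = w" and w: "w * f = e" and e: "e * e = e"
  shows "e = w ^ n * e * f ^ n"
proof (induction n)
  case (Suc n)
  have "e = w * e * f" using w we by simp
  also have "\<dots> = w * (w ^ n * e * f ^ n) * f" by (simp flip: Suc.IH)
  also have "\<dots> = w ^ Suc n * e * f ^ Suc n" by (simp add: mult.assoc power_commutes)
  finally show ?case .
qed simp

text \<open>
  Let \<open>e = a x\<close>, \<open>b = f - a\<close> and \<open>u = 1 + x b = (1 - e) + x f\<close>. As \<open>e\<close> commutes with \<open>a\<close>, the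
  condition on \<open>b\<close> transfers to \<open>f\<close>, which is therefore block triangular. If \<open>v u = 1\<close>, then
  \<open>u e = x f e\<close> gives \<open>e = v x f e\<close>.
\<close>

lemma same_projection_if_invariant:
  assumes a: "drazin_eqs a m x" and f: "drazin_eqs f k y"
    and inverse: "v * (1 + x * (f - a)) = 1"
    and invariant: "(1 - a * x) * (f - a) * (a * x) = 0"
    and kills: "f ^ k * (1 - a * x) = 0"
  shows "a * x = f * y"
proof -
  define e where "e = a * x"
  note A = drazin_eqs_projection[OF a, folded e_def]
  have "(f - a) * e = e * (f - a) * e"
    using invariant by (simp add: left_diff_distrib flip: e_def)
  moreover have "e * a * e = a * e" using A(4,5) by (simp add: mult.assoc)
  ultimately have inv: "f * e = e * (f * e)"
    by (simp add: left_diff_distrib right_diff_distrib mult.assoc)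
  have "(1 + x * (f - a)) * e = e + x * (f * e) - x * a * e"
    by (simp add: distrib_right left_diff_distrib right_diff_distrib mult.assoc)
  also have "\<dots> = x * (f * e)" using A(1,4) by (simp flip: e_def)
  finally have w: "v * x * (f * e) = e" using inverse by (metis mult.assoc mult_1_left)
  have fe: "f ^ k * e = f ^ k" using kills by (simp add: right_diff_distrib flip: e_def)
  have "e * f ^ k = f ^ k" using invariant_corner_power[OF A(4) inv, of k] fe by simp
  moreover have "e = (v * x) ^ k * f ^ k"
    using left_inverse_power_invariant[OF inv w, of k] fe by simp
  ultimately have "e = f * y" by (rule projections_eqI[OF f])
  then show ?thesis by (simp only: e_def)
qed

text \<open>
  In the notation of the preceding lemma, \<open>e u = x f\<close>. Here \<open>x f = x f e\<close>, so \<open>e\<close> commutes with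
  \<open>u\<close>, and \<open>v u e = e\<close> becomes \<open>e = v x f\<close>.
\<close>

lemma same_projection_if_coinvariant:
  assumes a: "drazin_eqs a m x" and f: "drazin_eqs f k y"
    and inverse: "v * (1 + x * (f - a)) = 1"
    and coinvariant: "a * x * (f - a) * (1 - a * x) = 0"
    and kills: "(1 - a * x) * f ^ k = 0"
  shows "a * x = f * y"
proof -
  define e where "e = a * x"
  note A = drazin_eqs_projection[OF a, folded e_def]
  have "e * (f - a) = e * (f - a) * e"
    using coinvariant by (simp add: right_diff_distrib flip: e_def)
  moreover have "e * a * e = e * a" using A(4,5) by (simp add: mult.assoc)
  ultimately have coinv: "e * f = e * f * e"
    by (simp add: left_diff_distrib right_diff_distrib)
  have "x * f = x * e * f" using A(3) by simp
  then have xfe: "x * f = x * f * e" using coinv A(3) by (metis mult.assoc)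
  have "(1 + x * (f - a)) * e = e + x * f * e - x * a * e"
    by (simp add: distrib_right left_diff_distrib right_diff_distrib)
  also have "\<dots> = x * f" using A(1,4) xfe by (simp flip: e_def)
  finally have w: "v * x * f = e" using inverse by (metis mult.assoc mult_1_left)
  have we: "v * x * e = v * x" using A(3) by (simp add: mult.assoc)
  have ef: "e * f ^ k = f ^ k" using kills by (simp add: left_diff_distrib flip: e_def)
  have "e = (v * x) ^ k * e * f ^ k"
    by (rule left_inverse_power_coinvariant[OF we w A(4)])
  then have "e = ((v * x) ^ k * e) * f ^ k" by simp
  with ef have "e = f * y" by (rule projections_eqI[OF f])
  then show ?thesis by (simp only: e_def)
qed

section \<open>The equivalences\<close>

theorem theorem3p7:
  fixes star :: "'a::{ring, monoid_mult} \<Rightarrow> 'a" and a b f :: 'a and k :: nat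
  assumes "ring_involution star"
    and "drazin_invertible a"
    and "f = a + b"
    and "drazin_invertible f"
    and "drazin_index f = k"
  shows
    "(a\<^sup>D * (a + f) * f\<^sup>D = a\<^sup>D + f\<^sup>D \<longleftrightarrow>
        ring_invertible (1 + a\<^sup>D * b) \<and> f\<^sup>D = ring_inverse (1 + a\<^sup>D * b) * a\<^sup>D) \<and>
     (a\<^sup>D * (a + f) * f\<^sup>D = a\<^sup>D + f\<^sup>D \<longleftrightarrow>
        ring_invertible (1 + a\<^sup>D * b) \<and> a * a\<^sup>D * b = b * a * a\<^sup>D \<and>
        (1 - a * a\<^sup>D) * (a + b) ^ k = 0) \<and>
     (a\<^sup>D * (a + f) * f\<^sup>D = a\<^sup>D + f\<^sup>D \<longleftrightarrow>
        ring_invertible (1 + a\<^sup>D * b) \<and> (1 - a * a\<^sup>D) * b * a * a\<^sup>D = 0 \<and>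
        (a + b) ^ k * (1 - a * a\<^sup>D) = 0) \<and>
     (a\<^sup>D * (a + f) * f\<^sup>D = a\<^sup>D + f\<^sup>D \<longleftrightarrow>
        ring_invertible (1 + a\<^sup>D * b) \<and> a * a\<^sup>D * b * (1 - a * a\<^sup>D) = 0 \<and>
        (1 - a * a\<^sup>D) * (a + b) ^ k = 0)"
proof -
  define x where "x = a\<^sup>D"
  define y where "y = f\<^sup>D"
  define u where "u = 1 + x * b"
  obtain m where a: "drazin_eqs a m x" using drazin_index(2)[OF assms(2)] x_def by blast
  have f: "drazin_eqs f k y" using drazin_index(2)[OF assms(4)] assms(5) y_def by simp
  have b: "b = f - a" using assms(3) by simp
  note A = drazin_eqs_projection[OF a]
  let ?same = "a * x = f * y"
  have 1: "x * (a + f) * y = x + y \<longleftrightarrow> ?same"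
    using absorption_law_iff[OF a f] absorption_iff_same_projection[OF a f] by simp
  have left_inverse: "\<exists>v. v * (1 + x * (f - a)) = 1" if "ring_invertible u"
    using that unfolding ring_invertible_def u_def b by blast
  have 2: "?same \<longleftrightarrow> ring_invertible u \<and> y = ring_inverse u * x"
  proof
    assume ?same
    then show "ring_invertible u \<and> y = ring_inverse u * x"
      using same_projection_ring_inverse[OF a f] by (simp add: u_def b)
  next
    assume H: "ring_invertible u \<and> y = ring_inverse u * x"
    then obtain v where v: "u * v = 1" "v * u = 1" unfolding ring_invertible_def by blast
    then have "y = v * x" using H ring_inverse_eqI by blast
    then have "(1 + x * (f - a)) * y = x" using v(1) by (simp add: u_def b flip: mult.assoc)
    then show ?same
      using absorption_of_solution[OF a f] absorption_iff_same_projection[OF a f] by simp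
  qed
  have forward: "ring_invertible u" "a * x * b = b * (a * x)" "(1 - a * x) * f ^ k = 0"
    "f ^ k * (1 - a * x) = 0" if ?same
    using 2 that same_projection_consequences[OF a f that] b by auto
  have corner: "(1 - a * x) * (a * x) = 0" "a * x * (1 - a * x) = 0"
    using A(4) by (simp_all add: left_diff_distrib right_diff_distrib)
  have 5: "?same \<longleftrightarrow> ring_invertible u \<and> a * x * b * (1 - a * x) = 0 \<and> (1 - a * x) * f ^ k = 0"
  proof
    assume ?same
    then show "ring_invertible u \<and> a * x * b * (1 - a * x) = 0 \<and> (1 - a * x) * f ^ k = 0"
      using forward corner by (simp add: mult.assoc)
  next
    assume "ring_invertible u \<and> a * x * b * (1 - a * x) = 0 \<and> (1 - a * x) * f ^ k = 0"
    then show ?same using left_inverse same_projection_if_coinvariant[OF a f] b by blast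
  qed
  have 4: "?same \<longleftrightarrow> ring_invertible u \<and> (1 - a * x) * b * (a * x) = 0 \<and> f ^ k * (1 - a * x) = 0"
  proof
    assume ?same
    then show "ring_invertible u \<and> (1 - a * x) * b * (a * x) = 0 \<and> f ^ k * (1 - a * x) = 0"
      using forward corner by (simp add: mult.assoc) (metis mult.assoc mult_zero_left)
  next
    assume "ring_invertible u \<and> (1 - a * x) * b * (a * x) = 0 \<and> f ^ k * (1 - a * x) = 0"
    then show ?same using left_inverse same_projection_if_invariant[OF a f] b by blast
  qed
  have 3: "?same \<longleftrightarrow> ring_invertible u \<and> a * x * b = b * (a * x) \<and> (1 - a * x) * f ^ k = 0"
  proof
    assume ?same
    then show "ring_invertible u \<and> a * x * b = b * (a * x) \<and> (1 - a * x) * f ^ k = 0"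
      using forward by simp
  next
    assume H: "ring_invertible u \<and> a * x * b = b * (a * x) \<and> (1 - a * x) * f ^ k = 0"
    then have "a * x * b * (1 - a * x) = 0" using corner by (simp add: mult.assoc)
    then show ?same using H 5 by simp
  qed
  have assoc: "b * a * x = b * (a * x)" "(1 - a * x) * b * a * x = (1 - a * x) * b * (a * x)"
    by (simp_all only: mult.assoc)
  show ?thesis
    unfolding x_def[symmetric] y_def[symmetric] assms(3)[symmetric] u_def[symmetric] assoc
    using 1 2 3 4 5 by simp
qed

end
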